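(* There exists a universal constant $c>0$ such that for any $x_1, x_2, \dots, x_N \in \mathbb{T}$, writing $D_N=D_N(\{x_1,\dots,x_N\})$ for the discrepancy, $$ D_N^2 \leq c \left( \frac{1}{N^2} \sum_{m,n = 1}^{N} \theta_{-\frac{D_N^2}{c \log D_N}}(x_n - x_m) - 1 \right).$$
   Context: $\mathbb{T}$ is the one-dimensional torus normalized to have length $1$. For $t>0$, the Jacobi $\theta$-function is $\theta_t(x) = 1 + 2 \sum_{n=1}^{\infty} e^{-4 \pi^2 n^2 t}\cos(2 \pi n x)$; in the claim it is used with parameter $t=-\frac{D_N^2}{c\log D_N}$. The discrepancy of $x_1,\dots,x_N\in\mathbb{T}$ is $$D_N(\{x_1, \dots, x_N\}) = \sup_{J \subset \mathbb{T}} \left| \frac{\#\{1 \leq i \leq N: x_i \in J\}}{N} - |J| \right|,$$ where the supremum is over all intervals $J\subset\mathbb{T}$ and $|J|$ is the length of $J$.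
   Formalization: Proved for point sets with D_N ≤ δ, for every δ < 1, with c depending on δ; no single universal c works, since for the two points 0, ε (D_N = 1−ε, ε → 0) the right side tends to 0, and at D_N = 1 the parameter is undefined. *)

theory Defs
  imports "HOL-Analysis.Analysis"
begin

(* The torus of length 1 is real/int. A point of it is given by an arbitrary real representative,
   and a subset is identified with the corresponding subset of the fundamental domain [0,1).
   The intervals (arcs) of the torus are the images of the real intervals, with or without
   endpoints, under the projection frac; so arcs through 0 are included. *)

definition torus_intervals :: "real set set" where
  "torus_intervals = {frac ` I |I. is_interval I}"

(* Points are counted by index, that is, with multiplicity. The discrepancy of N \<ge> 1 points lies in
   (0,1], and it equals 1 exactly when all the points coincide. *)

definition discrepancy :: "nat \<Rightarrow> (nat \<Rightarrow> real) \<Rightarrow> real" where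
  "discrepancy N x =
     (SUP J\<in>torus_intervals.
        \<bar>real (card {i \<in> {1..N}. frac (x i) \<in> J}) / real N - measure lborel J\<bar>)"

(* Only meaningful for t > 0, where the series converges. The sum starts at n = 1, hence Suc n. *)

definition jacobi_theta :: "real \<Rightarrow> real \<Rightarrow> real" where
  "jacobi_theta t x =
     1 + 2 * (\<Sum>n. exp (- 4 * pi\<^sup>2 * (real (Suc n))\<^sup>2 * t) * cos (2 * pi * real (Suc n) * x))"

end

theory Submission
  imports Defs
begin

text \<open>
  Let G(y) be the mean of frac (x_n - y). The arc [a, b) has deviation G(b) - G(a), so D is the
  oscillation of G, and G(y + s) \<ge> G(y) - s for s \<ge> 0. Hence, if G(b) - G(a) is nearly D, then
  G(b + r + s) - G(a - r + s) stays at least of order D for |s| \<le> r = D/8, and it never drops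
  below -D. Averaging over s against the Fejer kernel of degree M, where M is a large constant over
  D, gives a lower bound D/2. The average only involves frequencies k \<le> M, so by Cauchy-Schwarz
  and the Fourier coefficients of frac, D^2 is at most a constant times the sum over k \<le> M of the
  squared Weyl sums. The theta energy is the sum of these squares over all k \<ge> 1 with weights
  2 exp (-4 \<pi>^2 k^2 t), which are bounded below for k \<le> M as soon as M^2 t is bounded, i.e. when
  c ln (1/D) is bounded below.
\<close>

section \<open>Dirichlet and Fejer kernels\<close>

definition dirichlet_kernel :: "nat \<Rightarrow> real \<Rightarrow> real" where
  "dirichlet_kernel j x = 1 + 2 * (\<Sum>k=1..j. cos (2 * pi * real k * x))"

definition fejer_kernel :: "nat \<Rightarrow> real \<Rightarrow> real" where
  "fejer_kernel M x = (\<Sum>j<M. dirichlet_kernel j x) / real M"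

text \<open>Multiplying by the sine makes the cosine sum telescope; the product form stays valid at
  the integers, where the usual quotient is undefined.\<close>

lemma sin_times_dirichlet_kernel:
  "sin (pi * x) * dirichlet_kernel j x = sin (pi * (2 * real j + 1) * x)"
proof (induction j)
  case 0
  then show ?case by (simp add: dirichlet_kernel_def)
next
  case (Suc j)
  have "dirichlet_kernel (Suc j) x = dirichlet_kernel j x + 2 * cos (2 * pi * real (Suc j) * x)"
    by (simp add: dirichlet_kernel_def)
  then have "sin (pi * x) * dirichlet_kernel (Suc j) x =
      sin (pi * (2 * real j + 1) * x) + 2 * (sin (pi * x) * cos (2 * pi * real (Suc j) * x))"
    by (simp only: distrib_left Suc.IH mult.left_commute)
  also have "2 * (sin (pi * x) * cos (2 * pi * real (Suc j) * x)) =
      sin (pi * (2 * real (Suc j) + 1) * x) - sin (pi * (2 * real j + 1) * x)"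
  proof -
    have "pi * x + 2 * pi * real (Suc j) * x = pi * (2 * real (Suc j) + 1) * x"
      and "pi * x - 2 * pi * real (Suc j) * x = - (pi * (2 * real j + 1) * x)"
      by (simp_all add: algebra_simps)
    then show ?thesis
      by (simp add: sin_times_cos del: distrib_left_numeral of_nat_Suc)
  qed
  finally show ?case by simp
qed

text \<open>A second factor \<open>sin (pi * x)\<close> turns each Dirichlet term into a difference
  of consecutive squares, so the sum over j telescopes as well.\<close>

lemma sin_square_times_fejer_kernel:
  "(sin (pi * x))\<^sup>2 * (real M * fejer_kernel M x) = (sin (pi * real M * x))\<^sup>2"
proof -
  have *: "sin (pi * x) * sin (pi * (2 * real j + 1) * x) =
      (sin (pi * real (Suc j) * x))\<^sup>2 - (sin (pi * real j * x))\<^sup>2" for j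
  proof -
    have "pi * x - pi * (2 * real j + 1) * x = - (2 * (pi * real j * x))"
      and "pi * x + pi * (2 * real j + 1) * x = 2 * (pi * real (Suc j) * x)"
      by (simp_all add: algebra_simps)
    then show ?thesis
      by (simp only: sin_times_sin cos_minus cos_double_sin) simp
  qed
  have "(sin (pi * x))\<^sup>2 * (real M * fejer_kernel M x) =
      (\<Sum>j<M. sin (pi * x) * (sin (pi * x) * dirichlet_kernel j x))"
    by (cases "M = 0")
       (simp_all add: fejer_kernel_def power2_eq_square mult.assoc flip: sum_distrib_left)
  also have "\<dots> = (\<Sum>j<M. (sin (pi * real (Suc j) * x))\<^sup>2 - (sin (pi * real j * x))\<^sup>2)"
    by (simp only: sin_times_dirichlet_kernel *)
  also have "\<dots> = (sin (pi * real M * x))\<^sup>2"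
    by (subst sum_lessThan_telescope) simp
  finally show ?thesis .
qed

text \<open>Jordan's inequality: on [0, pi/2] the sine is concave and lies above its chord.\<close>

lemma sin_pi_mult_ge:
  assumes "\<bar>x\<bar> \<le> 1 / 2"
  shows "2 * \<bar>x\<bar> \<le> \<bar>sin (pi * x)\<bar>"
proof -
  have "concave_on {0..pi/2} (sin :: real \<Rightarrow> real)"
    by (rule f''_le0_imp_concave [where f' = cos and f'' = "\<lambda>x. - sin x"])
       (auto intro!: derivative_eq_intros sin_ge_zero)
  from concave_onD_Icc' [OF this, of "pi * \<bar>x\<bar>"] assms
  have "2 * \<bar>x\<bar> \<le> sin (pi * \<bar>x\<bar>)"
    by (simp add: field_simps)
  also have "\<dots> \<le> \<bar>sin (pi * x)\<bar>"
    by (cases "x \<ge> 0") auto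
  finally show ?thesis .
qed

lemma fejer_kernel_le:
  assumes "\<bar>x\<bar> \<le> 1 / 2" "x \<noteq> 0" "M > 0"
  shows "fejer_kernel M x \<le> 1 / (4 * real M * x\<^sup>2)"
    and "fejer_kernel M x \<ge> 0"
proof -
  have s: "4 * x\<^sup>2 \<le> (sin (pi * x))\<^sup>2"
    using power_mono [OF sin_pi_mult_ge [OF assms(1)], of 2] by (simp add: power_mult_distrib)
  have pos: "(sin (pi * x))\<^sup>2 > 0"
    using s assms(2) by (smt (verit) zero_less_power2)
  have "(sin (pi * x))\<^sup>2 * (real M * fejer_kernel M x) \<ge> 0"
    by (simp only: sin_square_times_fejer_kernel zero_le_power2)
  then show nn: "fejer_kernel M x \<ge> 0"
    using pos \<open>M > 0\<close> by (simp add: zero_le_mult_iff)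
  have "4 * x\<^sup>2 * (real M * fejer_kernel M x) \<le> (sin (pi * x))\<^sup>2 * (real M * fejer_kernel M x)"
    using s nn by (intro mult_right_mono) auto
  also have "\<dots> \<le> 1"
    by (simp add: sin_square_times_fejer_kernel abs_square_le_1)
  finally show "fejer_kernel M x \<le> 1 / (4 * real M * x\<^sup>2)"
    using assms by (simp add: field_simps)
qed

lemma fejer_kernel_nonneg:
  assumes "\<bar>x\<bar> \<le> 1 / 2"
  shows "fejer_kernel M x \<ge> 0"
\<comment> \<open>At 0 the closed form is void, but there all cosines equal 1; for M = 0 the kernel
  is \<open>0 / 0\<close>, which is 0.\<close>
proof (cases "x = 0 \<or> M = 0")
  case True
  then show ?thesis
    by (auto simp: fejer_kernel_def dirichlet_kernel_def intro!: divide_nonneg_nonneg sum_nonneg add_nonneg_nonneg)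
qed (use assms fejer_kernel_le in auto)

section \<open>Integrals against the kernels\<close>

lemma has_integral_dirichlet_kernel:
  "(dirichlet_kernel j has_integral 1) {-1/2..1/2}"
proof -
  define \<Phi> where "\<Phi> = (\<lambda>x. x + (\<Sum>k=1..j. sin (2 * pi * real k * x) / (pi * real k)))"
  have "(dirichlet_kernel j has_integral (\<Phi> (1/2) - \<Phi> (-1/2))) {-1/2..1/2}"
    unfolding \<Phi>_def dirichlet_kernel_def
    by (rule fundamental_theorem_of_calculus)
       (auto intro!: derivative_eq_intros sum.cong simp: sum_distrib_left
          simp flip: has_real_derivative_iff_has_vector_derivative)
  moreover have "\<Phi> (1/2) - \<Phi> (-1/2) = 1"
    by (simp add: \<Phi>_def mult.commute [of pi] sum_negf)
  ultimately show ?thesis by simp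
qed

lemma has_integral_fejer_kernel:
  assumes "M > 0"
  shows "(fejer_kernel M has_integral 1) {-1/2..1/2}"
proof -
  have "((\<lambda>x. (\<Sum>j<M. dirichlet_kernel j x) / real M) has_integral (\<Sum>j<M. 1) / real M) {-1/2..1/2}"
    by (intro has_integral_divide has_integral_sum has_integral_dirichlet_kernel) auto
  then show ?thesis
    using assms by (simp add: fejer_kernel_def [abs_def])
qed

text \<open>The value is the partial Fourier sum of \<open>frac\<close> at z. Integration by parts
  is done separately on the two sides of the jump of \<open>frac (z - x)\<close>.\<close>

lemma has_integral_dirichlet_kernel_frac:
  "((\<lambda>x. dirichlet_kernel j x * frac (z - x)) has_integral
      1 / 2 - (\<Sum>k=1..j. sin (2 * pi * real k * z) / (pi * real k))) {-1/2..1/2}"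
proof -
  \<comment> \<open>Subtracting an integer from z locates the jump at the point \<open>w\<close> of
    the interval of integration.\<close>
  define m where "m = \<lfloor>z + 1/2\<rfloor>"
  define w where "w = z - of_int m"
  have w: "-1/2 \<le> w" "w < 1/2"
    unfolding w_def m_def by linarith+
  have frac_w: "frac (z - x) = frac (w - x)" for x
    using frac_add_of_int_right [of "w - x" m] by (simp add: w_def algebra_simps)
  have sin_w: "sin (2 * pi * real k * z) = sin (2 * pi * real k * w)" for k
  proof -
    have "2 * pi * real k * z = 2 * pi * real k * w + of_int (int k * m) * (2 * pi)"
      by (simp add: w_def algebra_simps)
    then show ?thesis
      by (simp only: sin_add sin_int_2pin cos_int_2pin mult.commute [of _ "2 * pi"] mult_1_right mult_zero_right add_0_right)
  qed
  \<comment> \<open>Iterated antiderivatives of the kernel: against a linear factor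
    \<open>c - x\<close> the primitive is \<open>(c - x) * \<Phi> x + \<Psi> x\<close>.\<close>
  define \<Phi> where "\<Phi> = (\<lambda>x. x + (\<Sum>k=1..j. sin (2 * pi * real k * x) / (pi * real k)))"
  define \<Psi> where "\<Psi> = (\<lambda>x. x\<^sup>2 / 2 - (\<Sum>k=1..j. cos (2 * pi * real k * x) / (2 * pi\<^sup>2 * (real k)\<^sup>2)))"
  have d\<Phi> [derivative_intros]: "(\<Phi> has_real_derivative dirichlet_kernel j x) (at x within S)" for x S
    unfolding \<Phi>_def dirichlet_kernel_def
    by (auto intro!: derivative_eq_intros sum.cong simp: sum_distrib_left)
  have d\<Psi> [derivative_intros]: "(\<Psi> has_real_derivative \<Phi> x) (at x within S)" for x S
    unfolding \<Phi>_def \<Psi>_def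
    by (auto intro!: derivative_eq_intros sum.cong simp: power2_eq_square simp flip: sum_negf)
  have ftc: "((\<lambda>x. dirichlet_kernel j x * (c - x)) has_integral
      ((c - v) * \<Phi> v + \<Psi> v) - ((c - u) * \<Phi> u + \<Psi> u)) {u..v}" if "u \<le> v" for c u v
    by (rule fundamental_theorem_of_calculus [OF that])
       (auto intro!: derivative_eq_intros simp flip: has_real_derivative_iff_has_vector_derivative)
  have left: "frac (z - x) = w - x" if "x \<in> {-1/2..w}" for x
    using that w by (simp only: frac_w frac_eq) auto
  \<comment> \<open>Past the jump \<open>w - x\<close> is negative and \<open>frac\<close> adds 1.
    At \<open>w\<close> itself \<open>frac\<close> is 0, so this point is later removed as a
    spike.\<close>
  have right: "frac (z - x) = w + 1 - x" if "x \<in> {w..1/2} - {w}" for x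
    using that w by (simp only: frac_w frac_unique_iff) auto
  have "((\<lambda>x. dirichlet_kernel j x * frac (z - x)) has_integral
      ((w - w) * \<Phi> w + \<Psi> w) - ((w - (-1/2)) * \<Phi> (-1/2) + \<Psi> (-1/2))) {-1/2..w}"
    using left by (intro has_integral_spike_finite [where S = "{}", OF _ _ ftc [OF w(1), of w]]) auto
  moreover have "((\<lambda>x. dirichlet_kernel j x * frac (z - x)) has_integral
      ((w + 1 - 1/2) * \<Phi> (1/2) + \<Psi> (1/2)) - ((w + 1 - w) * \<Phi> w + \<Psi> w)) {w..1/2}"
    using right by (intro has_integral_spike_finite [where S = "{w}", OF _ _ ftc [OF less_imp_le [OF w(2)], of "w + 1"]]) auto
  ultimately have int: "((\<lambda>x. dirichlet_kernel j x * frac (z - x)) has_integral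
      (((w - w) * \<Phi> w + \<Psi> w) - ((w - (-1/2)) * \<Phi> (-1/2) + \<Psi> (-1/2))) +
      (((w + 1 - 1/2) * \<Phi> (1/2) + \<Psi> (1/2)) - ((w + 1 - w) * \<Phi> w + \<Psi> w))) {-1/2..1/2}"
    using w by (intro has_integral_combine) auto
  \<comment> \<open>\<open>\<Psi>\<close> is even and the sines vanish at both ends, so all that
    survives is \<open>1/2 + w - \<Phi> w\<close>.\<close>
  have "\<Psi> (-1/2) = \<Psi> (1/2)"
    by (simp add: \<Psi>_def power_divide)
  moreover have "\<Phi> (1/2) = 1/2" "\<Phi> (-1/2) = -1/2"
    by (simp_all add: \<Phi>_def mult.commute [of pi])
  moreover have "w - \<Phi> w = - (\<Sum>k=1..j. sin (2 * pi * real k * z) / (pi * real k))"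
    by (simp add: \<Phi>_def sin_w)
  ultimately have "(((w - w) * \<Phi> w + \<Psi> w) - ((w - (-1/2)) * \<Phi> (-1/2) + \<Psi> (-1/2))) +
      (((w + 1 - 1/2) * \<Phi> (1/2) + \<Psi> (1/2)) - ((w + 1 - w) * \<Phi> w + \<Psi> w)) =
      1 / 2 - (\<Sum>k=1..j. sin (2 * pi * real k * z) / (pi * real k))"
    by (simp only:) (simp add: algebra_simps)
  with int show ?thesis
    by (simp only:)
qed

lemma has_integral_cauchy_density:
  assumes "r > 0"
  shows "((\<lambda>x. 1 / (x\<^sup>2 + r\<^sup>2)) has_integral 2 / r * arctan (1 / (2 * r))) {-1/2..1/2}"
proof -
  have pos: "x\<^sup>2 + r\<^sup>2 > 0" for x
    using assms by (simp add: add_nonneg_pos)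
  have "((\<lambda>x. arctan (x / r) / r) has_real_derivative 1 / (x\<^sup>2 + r\<^sup>2)) (at x within S)" for x S
    using assms pos [of x]
    by (auto intro!: derivative_eq_intros simp: divide_simps power2_eq_square)
  then have "((\<lambda>x. 1 / (x\<^sup>2 + r\<^sup>2)) has_integral
      (arctan (1/2 / r) / r - arctan (-1/2 / r) / r)) {-1/2..1/2}"
    by (intro fundamental_theorem_of_calculus) (auto simp flip: has_real_derivative_iff_has_vector_derivative)
  then show ?thesis
    using arctan_minus [of "1 / (2 * r)"] by simp
qed

section \<open>Discrepancy and the mean sawtooth function\<close>

text \<open>In y each term falls with slope -1 and jumps up by 1 just after a point: up to a
  constant, a counting function with its linear trend removed.\<close>

definition saw_mean :: "nat \<Rightarrow> (nat \<Rightarrow> real) \<Rightarrow> real \<Rightarrow> real" where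
  "saw_mean N x y = (\<Sum>n=1..N. frac (x n - y)) / real N"

text \<open>Kept signed because surplus and deficit of an arc are estimated by different half-open
  arcs.\<close>

definition deviation :: "nat \<Rightarrow> (nat \<Rightarrow> real) \<Rightarrow> real set \<Rightarrow> real" where
  "deviation N x J = real (card {i \<in> {1..N}. frac (x i) \<in> J}) / real N - measure lborel J"

lemma saw_mean_add_ge:
  assumes "s \<ge> 0"
  shows "saw_mean N x (y + s) \<ge> saw_mean N x y - s"
proof (cases "N = 0")
  case False
  have "frac (z - (y + s)) \<ge> frac (z - y) - s" for z
    using floor_mono [of "z - (y + s)" "z - y"] assms by (simp add: frac_def)
  then have "(\<Sum>n=1..N. frac (x n - y) - s) \<le> (\<Sum>n=1..N. frac (x n - (y + s)))"
    by (intro sum_mono) auto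
  then have "((\<Sum>n=1..N. frac (x n - y)) - real N * s) / real N \<le> saw_mean N x (y + s)"
    unfolding saw_mean_def by (intro divide_right_mono) (simp_all add: sum_subtractf)
  then show ?thesis
    using False by (simp add: saw_mean_def diff_divide_distrib)
qed (use assms in \<open>simp add: saw_mean_def\<close>)

lemma saw_mean_add_of_int [simp]: "saw_mean N x (y + of_int k) = saw_mean N x y"
proof -
  have "frac (z - (y + of_int k)) = frac (z - y)" for z
    using frac_add_of_int_right [of "z - y" "- k"] by (simp add: algebra_simps)
  then show ?thesis by (simp add: saw_mean_def)
qed

lemma saw_mean_diff:
  assumes "N \<ge> 1"
  shows "saw_mean N x b - saw_mean N x a =
    (\<Sum>n=1..N. of_int (\<lfloor>x n - a\<rfloor> - \<lfloor>x n - b\<rfloor>)) / real N - (b - a)"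
proof -
  have "(\<Sum>n=1..N. frac (x n - b)) - (\<Sum>n=1..N. frac (x n - a)) =
      (\<Sum>n=1..N. of_int (\<lfloor>x n - a\<rfloor> - \<lfloor>x n - b\<rfloor>) - (b - a))"
    unfolding sum_subtractf [symmetric] by (intro sum.cong) (auto simp: frac_def)
  then have "saw_mean N x b - saw_mean N x a =
      ((\<Sum>n=1..N. of_int (\<lfloor>x n - a\<rfloor> - \<lfloor>x n - b\<rfloor>)) - real N * (b - a)) / real N"
    by (simp only: saw_mean_def diff_divide_distrib [symmetric] sum_subtractf sum_constant card_atLeastAtMost)
       (simp add: algebra_simps)
  then show ?thesis
    using assms by (simp add: diff_divide_distrib)
qed

section \<open>Arcs of the torus and their lengths\<close>

lemma frac_in_frac_image_iff:
  fixes y :: real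
  shows "frac y \<in> frac ` I \<longleftrightarrow> (\<exists>k. y + of_int k \<in> I)"
proof
  assume "frac y \<in> frac ` I"
  then obtain u where u: "u \<in> I" "frac y = frac u" by auto
  then have "y + of_int (\<lfloor>u\<rfloor> - \<lfloor>y\<rfloor>) = u" by (simp add: frac_def)
  with u show "\<exists>k. y + of_int k \<in> I" by metis
next
  assume "\<exists>k. y + of_int k \<in> I"
  then show "frac y \<in> frac ` I" by (metis frac_add_of_int_right imageI)
qed

lemma frac_image_eq_unit:
  fixes I :: "real set"
  assumes "is_interval I" "u \<in> I" "v \<in> I" "v - u \<ge> 1"
  shows "frac ` I = {0..<1}"
proof
  show "frac ` I \<subseteq> {0..<1}" by (auto simp: frac_lt_1)
  show "{0..<1} \<subseteq> frac ` I"
  proof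
    fix y :: real
    assume "y \<in> {0..<1}"
    then have y: "frac y = y" by simp
    \<comment> \<open>The ceiling selects the first translate of y that is not below u; it is less
      than u + 1, hence at most v.\<close>
    have "u \<le> y + of_int \<lceil>u - y\<rceil>" "y + of_int \<lceil>u - y\<rceil> \<le> v"
      using assms(4) by linarith+
    then have "y + of_int \<lceil>u - y\<rceil> \<in> I"
      using assms unfolding is_interval_1 by blast
    then show "y \<in> frac ` I"
      using frac_in_frac_image_iff [of y I] y by metis
  qed
qed

text \<open>Endpoints, present or not, affect only finitely many points; this removes the case split
  over open and closed ends.\<close>

lemma measure_sandwich_finite:
  fixes A J F :: "real set"
  assumes "A \<subseteq> J" "J \<subseteq> A \<union> F" "finite F" "A \<in> sets borel"
  shows "measure lborel J = measure lborel A"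
proof -
  have "J = A \<union> (J - A)" "finite (J - A)"
    using assms finite_subset [of "J - A" F] by auto
  then show ?thesis
    using assms(4) measure_Un_null_set [of A lborel "J - A"] finite_imp_null_set_lborel [of "J - A"]
    by simp
qed

text \<open>After an integer shift the interval starts in [0, 1), and its image is one segment or
  wraps once and splits in two. Length exactly 1 is allowed, since the wrapped ends then share at
  most a point.\<close>

lemma measure_frac_image:
  fixes I :: "real set"
  assumes "{p<..<q} \<subseteq> I" "I \<subseteq> {p..q}" "p \<le> q" "q \<le> p + 1"
  shows "measure lborel (frac ` I) = q - p"
proof -
  define m where "m = \<lfloor>p\<rfloor>"
  define p' where "p' = p - of_int m"
  define q' where "q' = q - of_int m"
  have p': "0 \<le> p'" "p' < 1" "p' \<le> q'" "q' \<le> p' + 1"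
    unfolding p'_def q'_def m_def using assms by linarith+
  have mem: "y \<in> frac ` I \<longleftrightarrow> (\<exists>k. y + of_int k + of_int m \<in> I) \<and> 0 \<le> y \<and> y < 1" for y
  proof (cases "0 \<le> y \<and> y < 1")
    case True
    have "(\<exists>k. y + of_int k \<in> I) \<longleftrightarrow> (\<exists>k. y + of_int k + of_int m \<in> I)"
      by (metis add.assoc of_int_add diff_add_cancel)
    with True show ?thesis
      using frac_in_frac_image_iff [of y I] by (metis frac_eq)
  qed (use frac_ge_0 frac_lt_1 in \<open>auto simp: not_le not_less [symmetric]\<close>)
  have inI: "y + of_int k + of_int m \<in> I \<Longrightarrow> p' \<le> y + of_int k \<and> y + of_int k \<le> q'" for y k
    using assms(2) by (force simp: p'_def q'_def)
  have Iin: "p' < y + of_int k \<Longrightarrow> y + of_int k < q' \<Longrightarrow> y + of_int k + of_int m \<in> I" for y k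
    using assms(1) by (force simp: p'_def q'_def)
  show ?thesis
  proof (cases "q' \<le> 1")
    case True
    have "measure lborel (frac ` I) = measure lborel {p'<..<q'}"
    proof (rule measure_sandwich_finite)
      show "{p'<..<q'} \<subseteq> frac ` I"
        using Iin [of _ 0] p' True by (auto simp: mem intro!: exI [of _ 0])
      \<comment> \<open>The point 0 enters when \<open>q' = 1\<close> and the right end belongs to
        I.\<close>
      show "frac ` I \<subseteq> {p'<..<q'} \<union> {p', q', 0}"
      proof
        fix y assume "y \<in> frac ` I"
        then obtain k where k: "p' \<le> y + of_int k" "y + of_int k \<le> q'" "0 \<le> y" "y < 1"
          using inI by (auto simp: mem)
        then have "k = 0 \<or> k = 1"
          using p' True by linarith
        then show "y \<in> {p'<..<q'} \<union> {p', q', 0}"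
          using k True by auto
      qed
    qed auto
    then show ?thesis
      using p' by (simp add: p'_def q'_def)
  next
    case False
    \<comment> \<open>The piece beyond 1 is moved back to the start; the two pieces are disjoint
      because \<open>q' - 1 \<le> p'\<close>.\<close>
    have "measure lborel (frac ` I) = measure lborel ({p'<..<1} \<union> {0<..<q'-1})"
    proof (rule measure_sandwich_finite)
      show "{p'<..<1} \<union> {0<..<q'-1} \<subseteq> frac ` I"
      proof
        fix y assume "y \<in> {p'<..<1} \<union> {0<..<q'-1}"
        then consider "p' < y" "y < 1" | "0 < y" "y < q' - 1" by auto
        then show "y \<in> frac ` I"
        proof cases
          case 1
          then show ?thesis
            using Iin [of y 0] p' False unfolding mem by (intro conjI exI [of _ 0]) auto
        next
          case 2
          then show ?thesis
            using Iin [of y 1] p' False unfolding mem by (intro conjI exI [of _ 1]) auto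
        qed
      qed
      show "frac ` I \<subseteq> ({p'<..<1} \<union> {0<..<q'-1}) \<union> {p', 0, q'-1}"
      proof
        fix y assume "y \<in> frac ` I"
        then obtain k where k: "p' \<le> y + of_int k" "y + of_int k \<le> q'" "0 \<le> y" "y < 1"
          using inI by (auto simp: mem)
        then have "k = 0 \<or> k = 1"
          using p' by linarith
        then show "y \<in> ({p'<..<1} \<union> {0<..<q'-1}) \<union> {p', 0, q'-1}"
          using k by auto
      qed
    qed auto
    also have "\<dots> = measure lborel {p'<..<1} + measure lborel {0<..<q'-1}"
      using p' False by (intro measure_Union) auto
    finally show ?thesis
      using p' False by (simp add: p'_def q'_def)
  qed
qed

lemma real_card_eq_sum: "real (card {i \<in> {1..N}. P i}) = (\<Sum>i=1..N. of_bool (P i))" for N :: nat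
  by (simp add: Int_def)

text \<open>A half-open arc shorter than 1 contains at most one translate of y, so the floor count
  is an indicator.\<close>

lemma frac_mem_arc_iff:
  fixes a b y :: real
  assumes "a \<le> b" "b < a + 1"
  shows "of_int (\<lfloor>y - a\<rfloor> - \<lfloor>y - b\<rfloor>) = (of_bool (frac y \<in> frac ` {a..<b}) :: real)"
proof (cases "frac y \<in> frac ` {a..<b}")
  case True
  then obtain k where k: "a \<le> y + of_int k" "y + of_int k < b"
    by (auto simp: frac_in_frac_image_iff)
  then have "\<lfloor>y - a\<rfloor> = - k" "\<lfloor>y - b\<rfloor> = - k - 1"
    using assms by linarith+
  then show ?thesis using True by simp
next
  case False
  then have "\<not> (a \<le> y + of_int (- \<lfloor>y - a\<rfloor>) \<and> y + of_int (- \<lfloor>y - a\<rfloor>) < b)"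
    by (metis frac_in_frac_image_iff atLeastLessThan_iff)
  then have "\<lfloor>y - b\<rfloor> = \<lfloor>y - a\<rfloor>"
    using assms by linarith
  then show ?thesis using False by simp
qed

section \<open>Discrepancy as the oscillation of the mean sawtooth\<close>

lemma deviation_half_open_arc:
  assumes "N \<ge> 1" "a \<le> b" "b < a + 1"
  shows "deviation N x (frac ` {a..<b}) = saw_mean N x b - saw_mean N x a"
proof -
  have "measure lborel (frac ` {a..<b}) = b - a"
    using assms by (intro measure_frac_image) auto
  then show ?thesis
    using assms by (simp only: deviation_def saw_mean_diff real_card_eq_sum frac_mem_arc_iff)
qed

text \<open>Bounds the family from above, so that its \<open>SUP\<close> dominates each
  member.\<close>

lemma abs_deviation_le_1:
  assumes "J \<in> torus_intervals"
  shows "\<bar>deviation N x J\<bar> \<le> 1"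
proof -
  have "real (card {i \<in> {1..N}. frac (x i) \<in> J}) \<le> real N"
    using card_mono [of "{1..N}" "{i \<in> {1..N}. frac (x i) \<in> J}"] by fastforce
  then have "real (card {i \<in> {1..N}. frac (x i) \<in> J}) / real N \<le> 1"
    by (simp add: divide_le_eq)
  \<comment> \<open>Non-measurable sets fall under the default value 0 of
    \<open>measure\<close>.\<close>
  moreover have "measure lborel J \<le> 1"
  proof (cases "J \<in> sets lborel")
    case True
    have "J \<subseteq> {0..1}"
      using assms by (auto simp: torus_intervals_def less_imp_le [OF frac_lt_1])
    then have "measure lborel J \<le> measure lborel {0..1::real}"
      using True by (intro measure_mono_fmeasurable) (auto simp: fmeasurable_def)
    then show ?thesis by simp
  qed (simp add: measure_notin_sets)
  moreover have "real (card {i \<in> {1..N}. frac (x i) \<in> J}) / real N \<ge> 0" "measure lborel J \<ge> 0"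
    by simp_all
  ultimately show ?thesis
    unfolding deviation_def by linarith
qed

lemma discrepancy_eq: "discrepancy N x = (SUP J\<in>torus_intervals. \<bar>deviation N x J\<bar>)"
  by (simp add: discrepancy_def deviation_def)

lemma abs_deviation_le_discrepancy:
  assumes "J \<in> torus_intervals"
  shows "\<bar>deviation N x J\<bar> \<le> discrepancy N x"
  unfolding discrepancy_eq
  by (rule cSUP_upper [OF assms bdd_aboveI2 [where M = 1]]) (rule abs_deviation_le_1)

lemma frac_image_in_torus_intervals: "is_interval I \<Longrightarrow> frac ` I \<in> torus_intervals"
  by (auto simp: torus_intervals_def)

text \<open>The degenerate arc at \<open>x 1\<close> has length 0 and carries at least one
  point.\<close>

lemma discrepancy_pos:
  assumes "N \<ge> 1"
  shows "discrepancy N x > 0"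
proof -
  have "1 \<in> {i \<in> {1..N}. frac (x i) \<in> frac ` {x 1}}"
    using assms by auto
  then have "card {i \<in> {1..N}. frac (x i) \<in> frac ` {x 1}} > 0"
    by (intro card_gt_0_iff [THEN iffD2]) auto
  then have "0 < deviation N x (frac ` {x 1})"
    using assms by (simp add: deviation_def)
  also have "\<dots> \<le> discrepancy N x"
    using abs_deviation_le_discrepancy [OF frac_image_in_torus_intervals, of "{x 1}" N x]
    by (simp add: is_interval_1)
  finally show ?thesis .
qed

text \<open>By periodicity b can be moved into [a, a + 1), where the difference is the deviation of
  an arc.\<close>

lemma abs_saw_mean_diff_le_discrepancy:
  assumes "N \<ge> 1"
  shows "\<bar>saw_mean N x b - saw_mean N x a\<bar> \<le> discrepancy N x"
proof -
  define b' where "b' = a + frac (b - a)"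
  have "b = b' + of_int \<lfloor>b - a\<rfloor>"
    by (simp add: b'_def frac_def)
  then have "saw_mean N x b = saw_mean N x b'"
    by (metis saw_mean_add_of_int)
  moreover have "\<bar>saw_mean N x b' - saw_mean N x a\<bar> \<le> discrepancy N x"
    unfolding b'_def
    by (subst deviation_half_open_arc [symmetric])
       (use assms in \<open>auto simp: frac_lt_1 is_interval_1
          intro!: abs_deviation_le_discrepancy frac_image_in_torus_intervals\<close>)
  ultimately show ?thesis by simp
qed

text \<open>An arc with endpoints p and q is enlarged to [p, q + \<epsilon>) to bound its surplus and shrunk to
  [p + \<epsilon>, q) to bound its deficit, so that only half-open arcs remain.\<close>

lemma abs_deviation_le_saw_mean_diff:
  assumes N: "N \<ge> 1" and J: "J \<in> torus_intervals" and "\<epsilon> > 0"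
  shows "\<exists>a b. \<bar>deviation N x J\<bar> \<le> saw_mean N x b - saw_mean N x a + \<epsilon>"
proof -
  obtain I where I: "J = frac ` I" "is_interval I"
    using J by (auto simp: torus_intervals_def)
  \<comment> \<open>An interval is empty, covers the torus, or has finite ends \<open>p\<close> and
    \<open>q\<close> with \<open>q \<le> p + 1\<close>; the first two kinds have deviation
    0.\<close>
  consider "I = {}" | u v where "u \<in> I" "v \<in> I" "v - u \<ge> 1"
    | "I \<noteq> {}" "\<And>u v. u \<in> I \<Longrightarrow> v \<in> I \<Longrightarrow> v - u < 1"
    by (meson not_le)
  then show ?thesis
  proof cases
    case 1
    then have "deviation N x J = 0"
      by (simp add: I deviation_def)
    then show ?thesis
      using \<open>\<epsilon> > 0\<close> by (intro exI [of _ 0]) simp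
  next
    case 2
    have "J = {0..<1}"
      using frac_image_eq_unit [OF I(2) 2] I(1) by simp
    then have "deviation N x J = 0"
      using N unfolding deviation_def real_card_eq_sum by (simp add: frac_lt_1)
    then show ?thesis
      using \<open>\<epsilon> > 0\<close> by (intro exI [of _ 0]) simp
  next
    case 3
    define p where "p = Inf I"
    define q where "q = Sup I"
    obtain u where "u \<in> I" using 3 by auto
    have "bdd_above I" "bdd_below I"
      using 3(2) [OF \<open>u \<in> I\<close>] 3(2) [OF _ \<open>u \<in> I\<close>]
      by (auto intro!: bdd_aboveI [of _ "u + 1"] bdd_belowI [of _ "u - 1"] simp: less_imp_le algebra_simps)
    then have sub: "I \<subseteq> {p..q}"
      by (auto simp: p_def q_def cInf_lower cSup_upper)
    have sup: "{p<..<q} \<subseteq> I"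
    proof
      fix y assume "y \<in> {p<..<q}"
      then obtain s t where "s \<in> I" "s < y" "t \<in> I" "y < t"
        using cInf_lessD [OF 3(1)] less_cSupD [OF 3(1)] unfolding p_def q_def
        by (metis greaterThanLessThan_iff)
      then show "y \<in> I"
        using I(2) unfolding is_interval_1 by (meson less_imp_le)
    qed
    have "p \<le> q" using sub \<open>u \<in> I\<close> by auto
    have "q \<le> p + 1"
    proof -
      have "v - 1 \<le> p" if "v \<in> I" for v
        unfolding p_def using 3 that by (intro cInf_greatest) (auto simp: less_imp_le algebra_simps)
      then show ?thesis
        unfolding q_def using 3 by (intro cSup_least) (auto simp: algebra_simps)
    qed
    have meas: "measure lborel J = q - p"
      unfolding I by (rule measure_frac_image [OF sup sub \<open>p \<le> q\<close> \<open>q \<le> p + 1\<close>])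
    \<comment> \<open>A translate in [p, q] also lies in [p, q + \<epsilon>), so the floor count is
      at least 1; larger counts, possible when this arc overlaps itself, do no harm to an upper
      bound.\<close>
    have "(of_bool (frac y \<in> J) :: real) \<le> of_int (\<lfloor>y - p\<rfloor> - \<lfloor>y - (q + \<epsilon>)\<rfloor>)" for y
    proof -
      have "\<lfloor>y - (q + \<epsilon>)\<rfloor> \<le> \<lfloor>y - p\<rfloor>"
        using \<open>p \<le> q\<close> \<open>\<epsilon> > 0\<close> by (intro floor_mono) simp
      moreover have "\<lfloor>y - (q + \<epsilon>)\<rfloor> < \<lfloor>y - p\<rfloor>" if yJ: "frac y \<in> J"
      proof -
        obtain k where "y + of_int k \<in> I"
          using yJ unfolding I(1) frac_in_frac_image_iff by blast
        then have "p \<le> y + of_int k" "y + of_int k \<le> q" using sub by auto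
        then have "- k \<le> \<lfloor>y - p\<rfloor>" "\<lfloor>y - (q + \<epsilon>)\<rfloor> < - k"
          using \<open>\<epsilon> > 0\<close> by linarith+
        then show ?thesis by simp
      qed
      ultimately show ?thesis
        by (cases "frac y \<in> J") (simp_all flip: of_int_diff add: le_diff_eq)
    qed
    then have "(\<Sum>n=1..N. (of_bool (frac (x n) \<in> J) :: real)) / real N \<le>
        (\<Sum>n=1..N. of_int (\<lfloor>x n - p\<rfloor> - \<lfloor>x n - (q + \<epsilon>)\<rfloor>)) / real N"
      by (intro divide_right_mono sum_mono) auto
    then have up: "deviation N x J \<le> saw_mean N x (q + \<epsilon>) - saw_mean N x p + \<epsilon>"
      unfolding saw_mean_diff [OF N] deviation_def real_card_eq_sum meas by linarith
    \<comment> \<open>The shrunk arc is shorter than 1, so it counts at most one translate, which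
      then lies strictly between p and q.\<close>
    have "of_int (\<lfloor>y - (p + \<epsilon>)\<rfloor> - \<lfloor>y - q\<rfloor>) \<le> (of_bool (frac y \<in> J) :: real)" for y
    proof -
      have "\<lfloor>y - (p + \<epsilon>)\<rfloor> - \<lfloor>y - q\<rfloor> \<le> 1"
        using \<open>q \<le> p + 1\<close> \<open>\<epsilon> > 0\<close> by linarith
      moreover have "frac y \<in> J" if "\<lfloor>y - q\<rfloor> < \<lfloor>y - (p + \<epsilon>)\<rfloor>"
      proof -
        have "y + of_int (- \<lfloor>y - (p + \<epsilon>)\<rfloor>) \<in> {p<..<q}"
          using that \<open>\<epsilon> > 0\<close> by simp linarith
        then show ?thesis
          using sup unfolding I frac_in_frac_image_iff by blast
      qed
      ultimately show ?thesis
        by (cases "frac y \<in> J") (auto simp flip: of_int_diff intro: leI)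
    qed
    then have "(\<Sum>n=1..N. of_int (\<lfloor>x n - (p + \<epsilon>)\<rfloor> - \<lfloor>x n - q\<rfloor>)) / real N \<le>
        (\<Sum>n=1..N. (of_bool (frac (x n) \<in> J) :: real)) / real N"
      by (intro divide_right_mono sum_mono) auto
    then have "saw_mean N x q - saw_mean N x (p + \<epsilon>) - \<epsilon> \<le> deviation N x J"
      unfolding saw_mean_diff [OF N] deviation_def real_card_eq_sum meas by linarith
    \<comment> \<open>For a deficit the endpoints change roles: a = q and b = p +
      \<epsilon>.\<close>
    with up show ?thesis
      by (cases "deviation N x J \<ge> 0") (force, rule exI [of _ q], rule exI [of _ "p + \<epsilon>"], linarith)
  qed
qed

lemma discrepancy_le_saw_mean_diff:
  assumes "N \<ge> 1" "\<epsilon> > 0"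
  shows "\<exists>a b. discrepancy N x - \<epsilon> \<le> saw_mean N x b - saw_mean N x a"
proof -
  \<comment> \<open>Half of \<epsilon> is spent on nearly reaching the supremum, half on passing to
    half-open arcs.\<close>
  have "\<exists>J\<in>torus_intervals. discrepancy N x - \<epsilon> / 2 < \<bar>deviation N x J\<bar>"
    unfolding discrepancy_eq
    by (rule less_cSupD [where X = "(\<lambda>J. \<bar>deviation N x J\<bar>) ` torus_intervals", simplified])
       (use assms in \<open>auto simp: torus_intervals_def\<close>)
  then obtain J where J: "J \<in> torus_intervals" "discrepancy N x - \<epsilon> / 2 < \<bar>deviation N x J\<bar>"
    by blast
  obtain a b where "\<bar>deviation N x J\<bar> \<le> saw_mean N x b - saw_mean N x a + \<epsilon> / 2"
    using abs_deviation_le_saw_mean_diff [OF assms(1) J(1), of "\<epsilon> / 2"] assms(2) half_gt_zero by blast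
  with J(2) show ?thesis by (intro exI [of _ a] exI [of _ b]) linarith
qed

section \<open>Weyl sums and the theta energy\<close>

text \<open>Squared modulus of the mean of exp (2 pi i k x_n), written in real form.\<close>

definition weyl_sum_square :: "nat \<Rightarrow> (nat \<Rightarrow> real) \<Rightarrow> nat \<Rightarrow> real" where
  "weyl_sum_square N x k =
     ((\<Sum>n=1..N. cos (2 * pi * real k * x n)) / real N)\<^sup>2 +
     ((\<Sum>n=1..N. sin (2 * pi * real k * x n)) / real N)\<^sup>2"

lemma weyl_sum_square_nonneg: "weyl_sum_square N x k \<ge> 0"
  by (simp add: weyl_sum_square_def)

text \<open>Shifting the points by y only rotates the complex Weyl sum, and an imaginary part is at
  most the modulus.\<close>

lemma abs_sin_mean_le:
  "\<bar>(\<Sum>n=1..N. sin (2 * pi * real k * (x n - y))) / real N\<bar> \<le> sqrt (weyl_sum_square N x k)"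
proof -
  define C where "C = (\<Sum>n=1..N. cos (2 * pi * real k * x n)) / real N"
  define S where "S = (\<Sum>n=1..N. sin (2 * pi * real k * x n)) / real N"
  define \<theta> where "\<theta> = 2 * pi * real k * y"
  have eq: "(\<Sum>n=1..N. sin (2 * pi * real k * (x n - y))) / real N = S * cos \<theta> - C * sin \<theta>"
    by (simp add: S_def C_def \<theta>_def right_diff_distrib sin_diff sum_subtractf sum_distrib_right diff_divide_distrib)
  have "(S * v - C * u)\<^sup>2 + (S * u + C * v)\<^sup>2 = (C\<^sup>2 + S\<^sup>2) * (u\<^sup>2 + v\<^sup>2)" for u v
    by (simp add: power2_eq_square algebra_simps)
  from this [where u = "sin \<theta>" and v = "cos \<theta>"] have "(S * cos \<theta> - C * sin \<theta>)\<^sup>2 \<le> C\<^sup>2 + S\<^sup>2"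
    using zero_le_power2 [of "S * sin \<theta> + C * cos \<theta>"]
    unfolding sin_cos_squared_add mult_1_right by linarith
  then show ?thesis
    unfolding eq by (simp add: weyl_sum_square_def C_def S_def real_le_rsqrt)
qed

section \<open>Fejer averages of the mean sawtooth\<close>

lemma has_integral_dirichlet_kernel_saw_mean:
  assumes "N \<ge> 1"
  shows "((\<lambda>s. dirichlet_kernel j s * saw_mean N x (y + s)) has_integral
     1 / 2 - (\<Sum>k=1..j. (\<Sum>n=1..N. sin (2 * pi * real k * (x n - y))) / real N / (pi * real k)))
     {-1/2..1/2}"
proof -
  have "((\<lambda>s. (\<Sum>n=1..N. dirichlet_kernel j s * frac ((x n - y) - s)) / real N) has_integral
     (\<Sum>n=1..N. 1 / 2 - (\<Sum>k=1..j. sin (2 * pi * real k * (x n - y)) / (pi * real k))) / real N)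
     {-1/2..1/2}"
    by (intro has_integral_divide has_integral_sum has_integral_dirichlet_kernel_frac) auto
  also have "(\<lambda>s. (\<Sum>n=1..N. dirichlet_kernel j s * frac ((x n - y) - s)) / real N) =
      (\<lambda>s. dirichlet_kernel j s * saw_mean N x (y + s))"
    by (simp add: saw_mean_def sum_distrib_left diff_diff_eq)
  also have "(\<Sum>n=1..N. 1 / 2 - (\<Sum>k=1..j. sin (2 * pi * real k * (x n - y)) / (pi * real k))) / real N =
      1 / 2 - (\<Sum>n=1..N. \<Sum>k=1..j. sin (2 * pi * real k * (x n - y)) / (pi * real k)) / real N"
    using assms by (simp add: sum_subtractf diff_divide_distrib)
  also have "(\<Sum>n=1..N. \<Sum>k=1..j. sin (2 * pi * real k * (x n - y)) / (pi * real k)) / real N =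
      (\<Sum>k=1..j. (\<Sum>n=1..N. sin (2 * pi * real k * (x n - y))) / real N / (pi * real k))"
    by (subst sum.swap) (simp add: sum_divide_distrib mult.commute divide_divide_eq_left)
  finally show ?thesis .
qed

text \<open>The constants 1/2 cancel in the difference. Every Dirichlet kernel of degree below M
  obeys the same bound, and the Fejer kernel is their average.\<close>

lemma fejer_kernel_saw_mean_diff_integral:
  assumes "N \<ge> 1" "M > 0"
  obtains I where
    "((\<lambda>s. fejer_kernel M s * (saw_mean N x (u + s) - saw_mean N x (v + s))) has_integral I) {-1/2..1/2}"
    "I \<le> (\<Sum>k=1..M. 2 / (pi * real k) * sqrt (weyl_sum_square N x k))"
proof -
  define \<sigma> where "\<sigma> k y = (\<Sum>n=1..N. sin (2 * pi * real k * (x n - y))) / real N" for k y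
  define B where "B = (\<Sum>k=1..M. 2 / (pi * real k) * sqrt (weyl_sum_square N x k))"
  define d where "d j = (\<Sum>k=1..j. (\<sigma> k v - \<sigma> k u) / (pi * real k))" for j :: nat
  have "((\<lambda>s. dirichlet_kernel j s * (saw_mean N x (u + s) - saw_mean N x (v + s))) has_integral d j) {-1/2..1/2}" for j
    using has_integral_diff [OF has_integral_dirichlet_kernel_saw_mean [OF assms(1), of j x u]
        has_integral_dirichlet_kernel_saw_mean [OF assms(1), of j x v]]
    by (simp add: d_def \<sigma>_def right_diff_distrib sum_subtractf diff_divide_distrib)
  then have int: "((\<lambda>s. (\<Sum>j<M. dirichlet_kernel j s * (saw_mean N x (u + s) - saw_mean N x (v + s))) / real M)
      has_integral (\<Sum>j<M. d j) / real M) {-1/2..1/2}"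
    by (intro has_integral_divide has_integral_sum) auto
  have "d j \<le> B" if "j < M" for j
  proof -
    have "d j \<le> (\<Sum>k=1..j. 2 / (pi * real k) * sqrt (weyl_sum_square N x k))"
      unfolding d_def
    proof (rule sum_mono)
      fix k assume "k \<in> {1..j}"
      have "\<sigma> k v - \<sigma> k u \<le> 2 * sqrt (weyl_sum_square N x k)"
        using abs_sin_mean_le [of k x v N] abs_sin_mean_le [of k x u N] unfolding \<sigma>_def by linarith
      then have "(\<sigma> k v - \<sigma> k u) / (pi * real k) \<le> 2 * sqrt (weyl_sum_square N x k) / (pi * real k)"
        by (intro divide_right_mono) auto
      then show "(\<sigma> k v - \<sigma> k u) / (pi * real k) \<le> 2 / (pi * real k) * sqrt (weyl_sum_square N x k)"
        by simp
    qed
    also have "\<dots> \<le> B"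
      unfolding B_def using that by (intro sum_mono2) (auto simp: weyl_sum_square_nonneg)
    finally show ?thesis .
  qed
  then have "(\<Sum>j<M. d j) \<le> real M * B"
    using sum_bounded_above [of "{..<M}" d B] by auto
  then have "(\<Sum>j<M. d j) / real M \<le> B"
    using assms(2) by (simp add: divide_le_eq mult.commute)
  moreover have "((\<lambda>s. fejer_kernel M s * (saw_mean N x (u + s) - saw_mean N x (v + s)))
      has_integral (\<Sum>j<M. d j) / real M) {-1/2..1/2}"
    using int by (simp add: fejer_kernel_def sum_distrib_right)
  ultimately show ?thesis
    using that unfolding B_def by blast
qed

text \<open>The Fejer kernel is bounded off [-r, r] by the multiple 1 / (2 M (s^2 + r^2)) of a Cauchy
  density: a single explicit integral then controls both tails.\<close>

lemma fejer_kernel_saw_mean_diff_ge: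
  assumes "N \<ge> 1" "M > 0" "r > 0"
    and V: "V = saw_mean N x b - saw_mean N x a" and D: "D = discrepancy N x"
    and nonneg: "V - 2 * r + D \<ge> 0"
    and I: "((\<lambda>s. fejer_kernel M s * (saw_mean N x (b + r + s) - saw_mean N x (a - r + s)))
      has_integral I) {-1/2..1/2}"
  shows "I \<ge> V - 2 * r - (V - 2 * r + D) * pi / (2 * real M * r)"
proof -
  have pw: "fejer_kernel M s * (V - 2 * r) - (V - 2 * r + D) / (2 * real M) * (1 / (s\<^sup>2 + r\<^sup>2))
      \<le> fejer_kernel M s * (saw_mean N x (b + r + s) - saw_mean N x (a - r + s))"
    if s: "s \<in> {-1/2..1/2}" for s
  proof (cases "\<bar>s\<bar> \<le> r")
    case True
    have "saw_mean N x b - (r + s) \<le> saw_mean N x (b + r + s)"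
      using saw_mean_add_ge [of "r + s" N x b] True by (simp add: add.assoc)
    moreover have "saw_mean N x (a - r + s) - (r - s) \<le> saw_mean N x a"
      using saw_mean_add_ge [of "r - s" N x "a - r + s"] True by simp
    \<comment> \<open>The losses \<open>r + s\<close> and \<open>r - s\<close> add up to
      \<open>2 * r\<close> independently of s.\<close>
    ultimately have "V - 2 * r \<le> saw_mean N x (b + r + s) - saw_mean N x (a - r + s)"
      unfolding V by linarith
    then have "fejer_kernel M s * (V - 2 * r) \<le>
        fejer_kernel M s * (saw_mean N x (b + r + s) - saw_mean N x (a - r + s))"
      using s by (intro mult_left_mono fejer_kernel_nonneg) auto
    moreover have "(V - 2 * r + D) / (2 * real M) * (1 / (s\<^sup>2 + r\<^sup>2)) \<ge> 0"
      using nonneg by (intro mult_nonneg_nonneg divide_nonneg_nonneg) auto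
    ultimately show ?thesis by linarith
  next
    case False
    then have "s \<noteq> 0" "r\<^sup>2 \<le> s\<^sup>2"
      using \<open>r > 0\<close> by (auto simp: abs_le_square_iff [symmetric])
    have K: "fejer_kernel M s \<ge> 0" "fejer_kernel M s \<le> 1 / (4 * real M * s\<^sup>2)"
      using fejer_kernel_le [of s M] s \<open>s \<noteq> 0\<close> \<open>M > 0\<close> by auto
    have "1 / (4 * real M * s\<^sup>2) \<le> 1 / (2 * real M * (s\<^sup>2 + r\<^sup>2))"
      using \<open>r\<^sup>2 \<le> s\<^sup>2\<close> \<open>M > 0\<close> \<open>r > 0\<close>
      by (intro frac_le) (auto simp: add_nonneg_pos)
    with K have "(V - 2 * r + D) * fejer_kernel M s \<le> (V - 2 * r + D) * (1 / (2 * real M * (s\<^sup>2 + r\<^sup>2)))"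
      using nonneg by (intro mult_left_mono) auto
    \<comment> \<open>Far from 0 only the bound -D is available; the subtracted term is at least
      \<open>V - 2 * r + D\<close> times the kernel and so lowers \<open>V - 2 * r\<close> to -D or
      below.\<close>
    moreover have "fejer_kernel M s * (- D) \<le>
        fejer_kernel M s * (saw_mean N x (b + r + s) - saw_mean N x (a - r + s))"
      using abs_saw_mean_diff_le_discrepancy [OF \<open>N \<ge> 1\<close>, of x "b + r + s" "a - r + s"] K
      unfolding D by (intro mult_left_mono) auto
    ultimately show ?thesis
      by (simp add: algebra_simps)
  qed
  have "((\<lambda>s. fejer_kernel M s * (V - 2 * r) - (V - 2 * r + D) / (2 * real M) * (1 / (s\<^sup>2 + r\<^sup>2)))
      has_integral 1 * (V - 2 * r) - (V - 2 * r + D) / (2 * real M) * (2 / r * arctan (1 / (2 * r))))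
      {-1/2..1/2}"
    using has_integral_fejer_kernel [OF \<open>M > 0\<close>] has_integral_cauchy_density [OF \<open>r > 0\<close>]
    by (intro has_integral_diff has_integral_mult_left has_integral_mult_right)
  from has_integral_le [OF this I] pw
  have "V - 2 * r - (V - 2 * r + D) / (2 * real M) * (2 / r * arctan (1 / (2 * r))) \<le> I"
    by simp
  moreover have "(V - 2 * r + D) / (2 * real M) * (2 / r * arctan (1 / (2 * r)))
      \<le> (V - 2 * r + D) / (2 * real M) * (2 / r * (pi / 2))"
    using nonneg \<open>r > 0\<close> arctan_ubound [of "1 / (2 * r)"]
    by (intro mult_left_mono divide_nonneg_nonneg) auto
  moreover have "(V - 2 * r + D) / (2 * real M) * (2 / r * (pi / 2)) =
      (V - 2 * r + D) * pi / (2 * real M * r)"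
    by simp
  ultimately show ?thesis
    by linarith
qed

lemma sum_inverse_squares_le: "(\<Sum>k=1..M. 1 / (real k)\<^sup>2) \<le> pi\<^sup>2 / 6"
proof -
  have "(\<Sum>k=1..M. 1 / (real k)\<^sup>2) = (\<Sum>k<M. 1 / (real k + 1)\<^sup>2)"
    by (rule sum.reindex_bij_witness [of _ Suc "\<lambda>k. k - 1"]) auto
  also have "\<dots> \<le> pi\<^sup>2 / 6"
    using sum_le_suminf [OF sums_summable [OF inverse_squares_sums], of "{..<M}"]
      sums_unique [OF inverse_squares_sums] by (simp add: add.commute)
  finally show ?thesis .
qed

text \<open>The Fejer average for a nearly extremal arc, with r = D/8, lies between D/2 and the Weyl
  sum bound. In Cauchy-Schwarz the squared weights sum to at most 2/3 whatever M is.\<close>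

lemma discrepancy_square_le_weyl_sums:
  assumes "N \<ge> 1" "256 \<le> real M * discrepancy N x"
  shows "(discrepancy N x)\<^sup>2 \<le> 4 * (\<Sum>k=1..M. weyl_sum_square N x k)"
proof -
  define D where "D = discrepancy N x"
  have "D > 0" "M > 0"
    using discrepancy_pos [OF assms(1)] assms(2) by (auto simp: D_def intro!: Nat.gr0I)
  obtain a b where ab: "D - D / 8 \<le> saw_mean N x b - saw_mean N x a"
    using discrepancy_le_saw_mean_diff [OF assms(1), of "D / 8" x] \<open>D > 0\<close> by (auto simp: D_def)
  define V where "V = saw_mean N x b - saw_mean N x a"
  have V: "7 / 8 * D \<le> V" "V \<le> D"
    using ab abs_saw_mean_diff_le_discrepancy [OF assms(1), of x b a] by (auto simp: V_def D_def)
  obtain I where I: "((\<lambda>s. fejer_kernel M s * (saw_mean N x (b + D / 8 + s) - saw_mean N x (a - D / 8 + s)))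
      has_integral I) {-1/2..1/2}"
    and upper: "I \<le> (\<Sum>k=1..M. 2 / (pi * real k) * sqrt (weyl_sum_square N x k))"
    using fejer_kernel_saw_mean_diff_integral [OF assms(1) \<open>M > 0\<close>] by blast
  have lower: "V - 2 * (D / 8) - (V - 2 * (D / 8) + D) * pi / (2 * real M * (D / 8)) \<le> I"
    using \<open>D > 0\<close> \<open>M > 0\<close> V by (intro fejer_kernel_saw_mean_diff_ge [OF assms(1) _ _ V_def D_def _ I]) auto
  have "pi / (2 * real M * (D / 8)) \<le> 4 / (2 * real M * (D / 8))"
    using pi_less_4 \<open>D > 0\<close> by (intro divide_right_mono) auto
  \<comment> \<open>The left side is \<open>16 / (real M * D)\<close>, which is what 256 is chosen
    for.\<close>
  also have "\<dots> \<le> 1 / 16"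
    using assms(2) \<open>D > 0\<close> \<open>M > 0\<close> by (simp add: D_def divide_simps)
  finally have "(V - 2 * (D / 8) + D) * (pi / (2 * real M * (D / 8))) \<le> (2 * D) * (1 / 16)"
    using V \<open>D > 0\<close> by (intro mult_mono) auto
  \<comment> \<open>The main term is at least 7D/8 - D/4 = 5D/8 and the tail costs at most
    D/8.\<close>
  with lower V have "D / 2 \<le> I"
    by simp
  with upper have "D / 2 \<le> (\<Sum>k=1..M. 2 / (pi * real k) * sqrt (weyl_sum_square N x k))"
    by linarith
  then have "(D / 2)\<^sup>2 \<le> (\<Sum>k=1..M. 2 / (pi * real k) * sqrt (weyl_sum_square N x k))\<^sup>2"
    using \<open>D > 0\<close> by (intro power_mono) auto
  also have "\<dots> \<le> (\<Sum>k=1..M. (2 / (pi * real k))\<^sup>2) * (\<Sum>k=1..M. (sqrt (weyl_sum_square N x k))\<^sup>2)"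
    by (rule Cauchy_Schwarz_ineq_sum)
  also have "(\<Sum>k=1..M. (2 / (pi * real k))\<^sup>2) = 4 / pi\<^sup>2 * (\<Sum>k=1..M. 1 / (real k)\<^sup>2)"
    by (simp add: sum_distrib_left power_divide power_mult_distrib)
  also have "\<dots> * (\<Sum>k=1..M. (sqrt (weyl_sum_square N x k))\<^sup>2) \<le>
      4 / pi\<^sup>2 * (pi\<^sup>2 / 6) * (\<Sum>k=1..M. (sqrt (weyl_sum_square N x k))\<^sup>2)"
    by (intro mult_right_mono mult_left_mono sum_inverse_squares_le sum_nonneg) auto
  also have "\<dots> = 2 / 3 * (\<Sum>k=1..M. weyl_sum_square N x k)"
    by (simp add: weyl_sum_square_nonneg)
  also have "\<dots> \<le> (\<Sum>k=1..M. weyl_sum_square N x k)"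
    using sum_nonneg [of "{1..M}" "weyl_sum_square N x"] weyl_sum_square_nonneg by simp
  finally show ?thesis
    by (simp add: D_def power_divide)
qed

section \<open>The theta energy as a weighted sum of Weyl sums\<close>

lemma summable_theta_terms:
  assumes "t > 0"
  shows "summable (\<lambda>n. exp (- 4 * pi\<^sup>2 * (real (Suc n))\<^sup>2 * t) * cos (c n))"
proof (rule summable_comparison_test')
  show "summable (\<lambda>n. exp (- 4 * pi\<^sup>2 * t) ^ n)"
    using assms by (intro summable_geometric) auto
  fix n :: nat
  have "real n \<le> (real (Suc n))\<^sup>2"
    by (simp add: power2_eq_square algebra_simps)
  then have "4 * pi\<^sup>2 * t * real n \<le> 4 * pi\<^sup>2 * t * (real (Suc n))\<^sup>2"
    using assms by (intro mult_left_mono) auto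
  then have "exp (- 4 * pi\<^sup>2 * (real (Suc n))\<^sup>2 * t) \<le> exp (- 4 * pi\<^sup>2 * t) ^ n"
    by (simp add: exp_of_nat_mult [symmetric] mult_ac)
  moreover have "\<bar>exp (- 4 * pi\<^sup>2 * (real (Suc n))\<^sup>2 * t) * cos (c n)\<bar> \<le> exp (- 4 * pi\<^sup>2 * (real (Suc n))\<^sup>2 * t) * 1"
    unfolding abs_mult by (intro mult_mono) auto
  ultimately show "norm (exp (- 4 * pi\<^sup>2 * (real (Suc n))\<^sup>2 * t) * cos (c n)) \<le> exp (- 4 * pi\<^sup>2 * t) ^ n"
    by simp
qed

text \<open>The addition formula for the cosine splits the double sum into two squares of single
  sums.\<close>

lemma sum_cos_diff_eq_weyl_sum_square:
  assumes "N \<ge> 1"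
  shows "(\<Sum>m=1..N. \<Sum>n=1..N. cos (2 * pi * real k * (x n - x m))) = (real N)\<^sup>2 * weyl_sum_square N x k"
proof -
  have "cos (2 * pi * real k * (x n - x m)) = cos (2 * pi * real k * x m) * cos (2 * pi * real k * x n) +
      sin (2 * pi * real k * x m) * sin (2 * pi * real k * x n)" for m n
    unfolding right_diff_distrib cos_diff by (simp only: mult.commute)
  then have "(\<Sum>m=1..N. \<Sum>n=1..N. cos (2 * pi * real k * (x n - x m))) =
      (\<Sum>n=1..N. cos (2 * pi * real k * x n))\<^sup>2 + (\<Sum>n=1..N. sin (2 * pi * real k * x n))\<^sup>2"
    by (simp only: sum.distrib power2_eq_square sum_product)
  then show ?thesis
    using assms by (simp add: weyl_sum_square_def power_divide distrib_left)
qed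

text \<open>The series is exchanged only with finite sums over m and n; the leading 1 of theta
  averages to 1 and is cancelled by the final -1.\<close>

lemma theta_energy_sums:
  assumes "N \<ge> 1" "t > 0"
  shows "(\<lambda>k. 2 * exp (- 4 * pi\<^sup>2 * (real (Suc k))\<^sup>2 * t) * weyl_sum_square N x (Suc k)) sums
    (1 / (real N)\<^sup>2 * (\<Sum>m=1..N. \<Sum>n=1..N. jacobi_theta t (x n - x m)) - 1)"
proof -
  let ?e = "\<lambda>k. exp (- 4 * pi\<^sup>2 * (real (Suc k))\<^sup>2 * t)"
  have "(\<lambda>k. ?e k * cos (2 * pi * real (Suc k) * z)) sums ((jacobi_theta t z - 1) / 2)" for z
    using summable_sums [OF summable_theta_terms [OF assms(2)]] by (simp add: jacobi_theta_def)
  then have "(\<lambda>k. \<Sum>m=1..N. \<Sum>n=1..N. ?e k * cos (2 * pi * real (Suc k) * (x n - x m))) sums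
      (\<Sum>m=1..N. \<Sum>n=1..N. (jacobi_theta t (x n - x m) - 1) / 2)"
    by (intro sums_sum)
  then have "(\<lambda>k. 2 / (real N)\<^sup>2 * (\<Sum>m=1..N. \<Sum>n=1..N. ?e k * cos (2 * pi * real (Suc k) * (x n - x m)))) sums
      (2 / (real N)\<^sup>2 * (\<Sum>m=1..N. \<Sum>n=1..N. (jacobi_theta t (x n - x m) - 1) / 2))"
    by (rule sums_mult)
  also have "(\<lambda>k. 2 / (real N)\<^sup>2 * (\<Sum>m=1..N. \<Sum>n=1..N. ?e k * cos (2 * pi * real (Suc k) * (x n - x m)))) =
      (\<lambda>k. 2 * ?e k * weyl_sum_square N x (Suc k))"
    using assms(1)
    by (simp only: sum_distrib_left [symmetric] sum_cos_diff_eq_weyl_sum_square [OF assms(1)])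
       (simp add: mult.assoc)
  also have "2 / (real N)\<^sup>2 * (\<Sum>m=1..N. \<Sum>n=1..N. (jacobi_theta t (x n - x m) - 1) / 2) =
      1 / (real N)\<^sup>2 * (\<Sum>m=1..N. \<Sum>n=1..N. jacobi_theta t (x n - x m)) - 1"
    using assms(1)
    by (simp add: sum_subtractf power2_eq_square right_diff_distrib diff_divide_distrib flip: sum_divide_distrib)
  finally show ?thesis .
qed

text \<open>For k \<le> M the exponent is at least -1, so each theta weight is at least 2/e; the
  discarded terms are nonnegative.\<close>

lemma weyl_sums_le_theta_energy:
  assumes "N \<ge> 1" "t > 0" "4 * pi\<^sup>2 * (real M)\<^sup>2 * t \<le> 1"
  shows "2 * (\<Sum>k=1..M. weyl_sum_square N x k) \<le>
    exp 1 * (1 / (real N)\<^sup>2 * (\<Sum>m=1..N. \<Sum>n=1..N. jacobi_theta t (x n - x m)) - 1)"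
proof -
  let ?f = "\<lambda>k. 2 * exp (- 4 * pi\<^sup>2 * (real (Suc k))\<^sup>2 * t) * weyl_sum_square N x (Suc k)"
  have "2 * weyl_sum_square N x (Suc k) \<le> exp 1 * ?f k" if "k < M" for k
  proof -
    have "4 * pi\<^sup>2 * (real (Suc k))\<^sup>2 * t \<le> 4 * pi\<^sup>2 * (real M)\<^sup>2 * t"
      using that assms(2) by (intro mult_right_mono mult_left_mono power_mono) auto
    then have "0 \<le> 1 + - 4 * pi\<^sup>2 * (real (Suc k))\<^sup>2 * t"
      using assms(3) by linarith
    then have "1 \<le> exp (1 + - 4 * pi\<^sup>2 * (real (Suc k))\<^sup>2 * t)"
      by (simp only: one_le_exp_iff)
    then have "1 * (2 * weyl_sum_square N x (Suc k)) \<le>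
        exp (1 + - 4 * pi\<^sup>2 * (real (Suc k))\<^sup>2 * t) * (2 * weyl_sum_square N x (Suc k))"
      by (rule mult_right_mono) (simp add: weyl_sum_square_nonneg)
    then show ?thesis
      by (simp only: exp_add mult_1_left mult_ac)
  qed
  then have "(\<Sum>k<M. 2 * weyl_sum_square N x (Suc k)) \<le> (\<Sum>k<M. exp 1 * ?f k)"
    by (intro sum_mono) auto
  also have "\<dots> = exp 1 * (\<Sum>k<M. ?f k)"
    by (simp only: sum_distrib_left)
  also have "\<dots> \<le> exp 1 * suminf ?f"
    using theta_energy_sums [OF assms(1,2), of x]
    by (intro mult_left_mono sum_le_suminf) (auto simp: weyl_sum_square_nonneg sums_iff)
  also have "suminf ?f = 1 / (real N)\<^sup>2 * (\<Sum>m=1..N. \<Sum>n=1..N. jacobi_theta t (x n - x m)) - 1"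
    by (rule sums_unique [OF theta_energy_sums [OF assms(1,2)], symmetric])
  also have "(\<Sum>k<M. 2 * weyl_sum_square N x (Suc k)) = (\<Sum>k=1..M. 2 * weyl_sum_square N x k)"
    by (rule sum.reindex_bij_witness [of _ "\<lambda>k. k - 1" Suc]) auto
  finally show ?thesis
    by (simp only: sum_distrib_left)
qed

text \<open>The constant c depends on \<open>\<delta>\<close> alone; \<open>\<delta> < 1\<close>
  keeps minus the logarithm of the discrepancy away from 0. For two points merging into one, the
  discrepancy tends to 1, the theta parameter grows without bound for fixed c and the energy
  vanishes, so no single c serves every \<open>\<delta>\<close>.\<close>

theorem corollary5:
  fixes \<delta> :: real
  assumes "\<delta> < 1"
  shows "\<exists>c>0. \<forall>(N::nat) (x::nat \<Rightarrow> real).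
           N \<ge> 1 \<longrightarrow> discrepancy N x \<le> \<delta> \<longrightarrow>
           (discrepancy N x)\<^sup>2 \<le>
             c * (1 / (real N)\<^sup>2 *
                    (\<Sum>m=1..N. \<Sum>n=1..N.
                       jacobi_theta (- ((discrepancy N x)\<^sup>2 / (c * ln (discrepancy N x)))) (x n - x m))
                  - 1)"
proof -
  \<comment> \<open>The maximum with 1/2 keeps the argument of \<open>ln\<close> positive when
    \<open>\<delta>\<close> is not.\<close>
  define \<delta>' where "\<delta>' = max \<delta> (1 / 2)"
  define L where "L = - ln \<delta>'"
  have "L > 0"
    using assms by (simp add: L_def \<delta>'_def max_def)
  \<comment> \<open>The 6 comes from D^2 \<le> 2 e E with e \<le> 3; \<open>64 * 257\<^sup>2\<close>
    is \<open>4 * 4\<^sup>2 * 257\<^sup>2\<close>, a bound for 4 pi^2 (M D)^2 when pi < 4 and M D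
    \<le> 257.\<close>
  define c where "c = max 6 (64 * 257\<^sup>2 / L)"
  have c: "c \<ge> 6" "64 * 257\<^sup>2 \<le> c * L"
    using \<open>L > 0\<close> by (auto simp: c_def max_def field_simps)
  show ?thesis
  proof (intro exI [of _ c] conjI allI impI)
    show "c > 0" using c by simp
    fix N :: nat and x :: "nat \<Rightarrow> real"
    assume N: "N \<ge> 1" and le: "discrepancy N x \<le> \<delta>"
    define D where "D = discrepancy N x"
    define t where "t = - (D\<^sup>2 / (c * ln D))"
    define E where "E = 1 / (real N)\<^sup>2 * (\<Sum>m=1..N. \<Sum>n=1..N. jacobi_theta t (x n - x m)) - 1"
    have D: "0 < D" "D \<le> \<delta>'" "D < 1"
      using discrepancy_pos [OF N] le assms by (auto simp: D_def \<delta>'_def)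
    have ln: "L \<le> - ln D"
      using D by (simp add: L_def)
    have t: "t = D\<^sup>2 / (c * (- ln D))"
      by (simp add: t_def)
    have pos: "0 < c * (- ln D)"
      using D ln \<open>L > 0\<close> c by (intro mult_pos_pos) auto
    then have "t > 0"
      unfolding t using D by (intro divide_pos_pos) auto
    \<comment> \<open>The smallest degree with M D \<ge> 256; rounding up adds at most D < 1, hence
      257.\<close>
    define M where "M = nat \<lceil>256 / D\<rceil>"
    have M: "256 \<le> real M * D" "real M * D \<le> 257"
    proof -
      have "256 / D \<le> real M" "real M \<le> 256 / D + 1"
        unfolding M_def using D by (auto simp: of_nat_ceiling)
      then show "256 \<le> real M * D"
        using D by (simp add: divide_le_eq)
      have "real M * D \<le> (256 / D + 1) * D"
        using D \<open>real M \<le> 256 / D + 1\<close> by (intro mult_right_mono) auto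
      then show "real M * D \<le> 257"
        using D by (simp add: distrib_right)
    qed
    have "4 * pi\<^sup>2 * (real M)\<^sup>2 * D\<^sup>2 \<le> 4 * 4\<^sup>2 * 257\<^sup>2"
      using M D pi_less_4 unfolding mult.assoc power_mult_distrib [symmetric]
      by (intro mult_left_mono power_mono mult_mono) (auto simp: mult_ac)
    also have "\<dots> \<le> c * (- ln D)"
      using c ln mult_left_mono [OF ln, of c] by simp
    finally have "4 * pi\<^sup>2 * (real M)\<^sup>2 * t \<le> 1"
      unfolding t times_divide_eq_right using divide_le_eq_1_pos [OF pos] by blast
    then have "2 * (\<Sum>k=1..M. weyl_sum_square N x k) \<le> exp 1 * E"
      unfolding E_def by (rule weyl_sums_le_theta_energy [OF N \<open>t > 0\<close>])
    moreover have "(\<Sum>k=1..M. weyl_sum_square N x k) \<ge> 0"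
      by (intro sum_nonneg weyl_sum_square_nonneg)
    \<comment> \<open>Nonnegativity allows \<open>exp 1\<close> to be raised to 3 and 6 to
      c.\<close>
    ultimately have "E \<ge> 0"
      by (smt (verit) exp_gt_zero mult_pos_neg)
    have "D\<^sup>2 \<le> 2 * (2 * (\<Sum>k=1..M. weyl_sum_square N x k))"
      using discrepancy_square_le_weyl_sums [OF N, of M x] M by (simp add: D_def)
    also have "\<dots> \<le> 2 * (3 * E)"
      using \<open>2 * _ \<le> exp 1 * E\<close> mult_right_mono [OF exp_le \<open>E \<ge> 0\<close>] by linarith
    also have "\<dots> \<le> c * E"
      using c(1) \<open>E \<ge> 0\<close> mult_right_mono [OF c(1) \<open>E \<ge> 0\<close>] by simp
    finally show "(discrepancy N x)\<^sup>2 \<le> c * (1 / (real N)\<^sup>2 * (\<Sum>m=1..N. \<Sum>n=1..N.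
        jacobi_theta (- ((discrepancy N x)\<^sup>2 / (c * ln (discrepancy N x)))) (x n - x m)) - 1)"
      by (simp only: E_def t_def D_def)
  qed
qed

end
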